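(* Let $q$ be a fixed prime power. Then, as $n\to\infty$, $B_q(n,2,2;3)=o(q^{2n})$.
   Context: For a prime power $q$, $\mathcal{G}_q(n,k)$ denotes the set of all $k$-dimensional subspaces of $\mathbb{F}_q^n$. An $\alpha$-$(n,k,\delta)_q^c$ covering Grassmannian code is a subset $\mathcal{C}\subseteq\mathcal{G}_q(n,k)$ (no repeated codewords) such that every set of $\alpha$ distinct codewords of $\mathcal{C}$ spans a subspace of $\mathbb{F}_q^n$ of dimension at least $k+\delta$. $B_q(n,k,\delta;\alpha)$ denotes the maximum size of an $\alpha$-$(n,k,\delta)_q^c$ code. *)

theory Defs
  imports Main "HOL-Library.Landau_Symbols"
begin

text \<open>Vectors of F_q^n are represented as functions nat => 'a that vanish
  outside the index set {0..<n}; 'a is a finite field with q = CARD('a) elements.\<close>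

definition vecs :: "nat \<Rightarrow> (nat \<Rightarrow> 'a::field) set" where
  "vecs n = {v. \<forall>i\<ge>n. v i = 0}"

definition fspan :: "(nat \<Rightarrow> 'a::field) set \<Rightarrow> (nat \<Rightarrow> 'a) set" where
  "fspan S = {v. \<exists>T c. finite T \<and> T \<subseteq> S \<and> v = (\<lambda>i. \<Sum>u\<in>T. c u * u i)}"

definition fdim :: "(nat \<Rightarrow> 'a::field) set \<Rightarrow> nat" where
  "fdim W = (LEAST d. \<exists>B. finite B \<and> B \<subseteq> W \<and> card B = d \<and> fspan B = W)"

definition grassmannian :: "nat \<Rightarrow> nat \<Rightarrow> (nat \<Rightarrow> 'a::field) set set" where
  "grassmannian n k = {W. W \<subseteq> vecs n \<and> fspan W = W \<and> fdim W = k}"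

definition covering_code ::
  "nat \<Rightarrow> nat \<Rightarrow> nat \<Rightarrow> nat \<Rightarrow> (nat \<Rightarrow> 'a::field) set set \<Rightarrow> bool" where
  "covering_code n k \<delta> \<alpha> C \<longleftrightarrow> C \<subseteq> grassmannian n k \<and>
     (\<forall>S \<subseteq> C. card S = \<alpha> \<longrightarrow> fdim (fspan (\<Union>S)) \<ge> k + \<delta>)"

text \<open>B_q(n,k,delta;alpha), the field (hence q) given by the type 'a.\<close>
definition B_cov :: "'a::{finite,field} itself \<Rightarrow> nat \<Rightarrow> nat \<Rightarrow> nat \<Rightarrow> nat \<Rightarrow> nat" where
  "B_cov _ n k \<delta> \<alpha> = Max {card C | C. covering_code n k \<delta> \<alpha> (C :: (nat \<Rightarrow> 'a) set set)}"

end

theory Submission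
  imports Defs "HOL-Library.Function_Algebras"
begin

text \<open>
  Choose for every codeword \<open>L\<close> a generating pair \<open>(u, v)\<close>, and let \<open>G\<close> be the set of these pairs.
  If \<open>(u, v)\<close>, \<open>(u', v')\<close>, \<open>(u, v')\<close> lie in \<open>G\<close> and \<open>u + v = u' + v'\<close>, the three corresponding
  codewords all lie in the span of \<open>u, v, v'\<close>, so they cannot be distinct: \<open>G\<close> contains no
  corner. It remains to show that a corner-free subset of \<open>V \<times> V\<close> has size \<open>o(N\<^sup>2)\<close>, \<open>N = |V|\<close>.

  This is a regularity argument in the style of Ruzsa and Szemeredi. View \<open>G\<close> as a bipartite graph
  in which the edge \<open>(u, v)\<close> has label \<open>u + v\<close>; the edges of one label form an induced matching.
  Approximate the indicator function of \<open>G\<close> by a function \<open>h\<close> constant on the blocks \<open>A \<times> B\<close> of a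
  partition of \<open>V\<close>. If \<open>G\<close> is dense, then either \<open>h\<close> is too small on many edges and raising it there
  improves the approximation, or many blocks on which \<open>h\<close> is bounded below contain an edge whose
  matching covers positive proportions \<open>X\<close> of \<open>A\<close> and \<open>Y\<close> of \<open>B\<close>. As \<open>G\<close> has at most \<open>N\<close> edges in
  \<open>X \<times> Y\<close>, setting \<open>h\<close> to zero there improves the approximation. In both cases the squared
  error drops by a fixed multiple of \<open>N\<^sup>2\<close>, which can happen only boundedly often.
\<close>

section \<open>Corners in Latin squares\<close>

text \<open>A class that contributes contains a thin point, so \<open>D\<close> meets it in fewer
  than \<open>\<eta>\<close> times its size; summing over the classes gives the bound.\<close>

lemma card_thin_classes_le:
  fixes \<kappa> :: "'v \<Rightarrow> nat" and \<eta> :: real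
  assumes "finite V" "D \<subseteq> V" "\<eta> \<ge> 0"
  shows "real (card {x\<in>D. real (card (D \<inter> {z\<in>V. \<kappa> z = \<kappa> x})) < \<eta> * real (card {z\<in>V. \<kappa> z = \<kappa> x})})
          \<le> \<eta> * real (card V)"
proof -
  let ?cls = "\<lambda>a. {z\<in>V. \<kappa> z = a}"
  let ?S = "{x\<in>D. real (card (D \<inter> ?cls (\<kappa> x))) < \<eta> * real (card (?cls (\<kappa> x)))}"
  have fin: "finite ?S" "finite D" using assms by (auto intro: finite_subset)
  have sub: "?S \<subseteq> V" using assms by auto
  have "real (card {x\<in>?S. \<kappa> x = a}) \<le> \<eta> * real (card (?cls a))" for a
  proof (cases "{x\<in>?S. \<kappa> x = a} = {}")
    case True
    then show ?thesis using assms(3) by (simp only: card.empty) simp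
  next
    case False
    then obtain x where x: "x \<in> ?S" "\<kappa> x = a" by blast
    have "{x\<in>?S. \<kappa> x = a} \<subseteq> D \<inter> ?cls a" using assms(2) by auto
    then have "card {x\<in>?S. \<kappa> x = a} \<le> card (D \<inter> ?cls a)"
      using fin by (intro card_mono) auto
    then show ?thesis using x by fastforce
  qed
  then have "(\<Sum>a\<in>\<kappa> ` V. real (card {x\<in>?S. \<kappa> x = a})) \<le> (\<Sum>a\<in>\<kappa> ` V. \<eta> * real (card (?cls a)))"
    by (intro sum_mono)
  moreover have "(\<Sum>a\<in>\<kappa> ` V. real (card {x\<in>?S. \<kappa> x = a})) = real (card ?S)"
    using sum.group[OF fin(1), of "\<kappa> ` V" \<kappa> "\<lambda>_. 1::real"] sub assms(1) by auto
  moreover have "(\<Sum>a\<in>\<kappa> ` V. \<eta> * real (card (?cls a))) = \<eta> * real (card V)"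
    using sum.group[OF assms(1), of "\<kappa> ` V" \<kappa> "\<lambda>_. 1::real"] assms(1)
    by (simp add: sum_distrib_left[symmetric])
  ultimately show ?thesis by linarith
qed

section \<open>Corner-free sets and their block approximations\<close>

text \<open>The Latin square \<open>s\<close> abstracts addition. A corner is an edge
  \<open>(x, y')\<close> meeting two edges of equal label; the conclusion \<open>y = y'\<close> also
  gives \<open>x = x'\<close> by \<open>cancel_right\<close>, so every corner is degenerate.\<close>

locale latin_corner_free =
  fixes V :: "'v set" and W :: "'w set" and G :: "('v \<times> 'v) set" and s :: "'v \<Rightarrow> 'v \<Rightarrow> 'w"
  assumes finite_V: "finite V" and finite_W: "finite W" and card_W: "card W \<le> card V"
    and s_in: "\<And>x y. x \<in> V \<Longrightarrow> y \<in> V \<Longrightarrow> s x y \<in> W"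
    and cancel_left: "\<And>x y y'. x \<in> V \<Longrightarrow> y \<in> V \<Longrightarrow> y' \<in> V \<Longrightarrow> s x y = s x y' \<Longrightarrow> y = y'"
    and cancel_right: "\<And>x x' y. x \<in> V \<Longrightarrow> x' \<in> V \<Longrightarrow> y \<in> V \<Longrightarrow> s x y = s x' y \<Longrightarrow> x = x'"
    and G_sub: "G \<subseteq> V \<times> V"
    and corner_free: "\<And>x y x' y'. (x, y) \<in> G \<Longrightarrow> (x', y') \<in> G \<Longrightarrow> (x, y') \<in> G
                        \<Longrightarrow> s x y = s x' y' \<Longrightarrow> y = y'"
begin

text \<open>\<open>rows w\<close> and \<open>cols w\<close> are the two sides of the matching formed
  by the edges of label \<open>w\<close>.\<close>

definition rows :: "'w \<Rightarrow> 'v set" where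
  "rows w = {x. \<exists>y. (x, y) \<in> G \<and> s x y = w}"

definition cols :: "'w \<Rightarrow> 'v set" where
  "cols w = {y. \<exists>x. (x, y) \<in> G \<and> s x y = w}"

definition cell :: "('v \<Rightarrow> nat) \<Rightarrow> nat \<Rightarrow> 'v set" where
  "cell \<kappa> a = {z\<in>V. \<kappa> z = a}"

text \<open>Squared L2 distance from the indicator of \<open>G\<close> to a function constant on
  blocks. Numbering the classes lets one type carry all successive refinements.\<close>

definition resid :: "('v \<Rightarrow> nat) \<Rightarrow> (nat \<Rightarrow> nat \<Rightarrow> real) \<Rightarrow> real" where
  "resid \<kappa> h = (\<Sum>p\<in>V \<times> V. (of_bool (p \<in> G) - h (\<kappa> (fst p)) (\<kappa> (snd p)))\<^sup>2)"

lemma rows_sub: "rows w \<subseteq> V" and cols_sub: "cols w \<subseteq> V"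
  using G_sub by (auto simp: rows_def cols_def)

lemma finite_G: "finite G"
  using G_sub finite_V by (meson finite_SigmaI finite_subset)

lemma finite_rows: "finite (rows w)" and finite_cols: "finite (cols w)"
  and finite_cell: "finite (cell \<kappa> a)"
  using finite_subset[OF rows_sub finite_V] finite_subset[OF cols_sub finite_V] finite_V
  by (simp_all add: cell_def)

text \<open>The edges of a fixed label form an induced matching.\<close>

lemma card_G_rows_cols: "card (G \<inter> rows w \<times> cols w) \<le> card V"
proof (rule card_inj_on_le)
  \<comment> \<open>The edges of label \<open>w\<close> through \<open>x\<close> and
    \<open>y\<close> form a corner with \<open>(x, y)\<close>, which forces them to coincide with
    it.\<close>
  have "s x y = w" if xy: "(x, y) \<in> G" "x \<in> rows w" "y \<in> cols w" for x y
  proof -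
    obtain y' x' where "(x, y') \<in> G" "s x y' = w" "(x', y) \<in> G" "s x' y = w"
      using xy unfolding rows_def cols_def by blast
    then show ?thesis using corner_free[of x y' x' y] xy(1) by simp
  qed
  then show "inj_on fst (G \<inter> rows w \<times> cols w)"
    using G_sub by (fastforce simp: inj_on_def intro: cancel_left)
qed (use G_sub finite_V in auto)

section \<open>Counting exceptional edges\<close>

text \<open>The label and \<open>x\<close> determine \<open>y\<close>, so these edges inject into
  pairs of a label \<open>w\<close> and a thin point of \<open>rows w\<close>. There are at most
  \<open>card V\<close> labels, each with at most \<open>\<eta> * card V\<close> thin
  points.\<close>

lemma card_thin_rows:
  assumes "\<eta> \<ge> 0"
  shows "real (card {(x, y) \<in> G. real (card (rows (s x y) \<inter> cell \<kappa> (\<kappa> x))) < \<eta> * real (card (cell \<kappa> (\<kappa> x)))})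
          \<le> \<eta> * (real (card V))\<^sup>2"
proof -
  let ?Q = "\<lambda>w. {x\<in>rows w. real (card (rows w \<inter> cell \<kappa> (\<kappa> x))) < \<eta> * real (card (cell \<kappa> (\<kappa> x)))}"
  let ?S = "{(x, y) \<in> G. real (card (rows (s x y) \<inter> cell \<kappa> (\<kappa> x))) < \<eta> * real (card (cell \<kappa> (\<kappa> x)))}"
  have "card ?S \<le> card (Sigma W ?Q)"
  proof (rule card_inj_on_le[where f = "\<lambda>(x, y). (s x y, x)"])
    show "inj_on (\<lambda>(x, y). (s x y, x)) ?S"
      using G_sub by (fastforce simp: inj_on_def intro: cancel_left)
    show "(\<lambda>(x, y). (s x y, x)) ` ?S \<subseteq> Sigma W ?Q"
      using G_sub s_in by (auto simp: rows_def)
    show "finite (Sigma W ?Q)" using finite_W finite_rows by auto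
  qed
  also have "card (Sigma W ?Q) = (\<Sum>w\<in>W. card (?Q w))"
    using finite_W finite_rows by (intro card_SigmaI) auto
  finally have "real (card ?S) \<le> (\<Sum>w\<in>W. real (card (?Q w)))"
    unfolding of_nat_sum[symmetric] of_nat_le_iff .
  also have "\<dots> \<le> (\<Sum>w\<in>W. \<eta> * real (card V))"
    using card_thin_classes_le[OF finite_V rows_sub assms, of _ \<kappa>]
    by (intro sum_mono) (simp add: cell_def)
  also have "\<dots> = real (card W) * (\<eta> * real (card V))" by simp
  also have "\<dots> \<le> real (card V) * (\<eta> * real (card V))"
    using card_W assms by (intro mult_right_mono) auto
  finally show ?thesis by (simp add: power2_eq_square mult_ac)
qed

text \<open>Transposing both the graph and the square turns columns into rows.\<close>

lemma card_thin_cols: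
  assumes "\<eta> \<ge> 0"
  shows "real (card {(x, y) \<in> G. real (card (cols (s x y) \<inter> cell \<kappa> (\<kappa> y))) < \<eta> * real (card (cell \<kappa> (\<kappa> y)))})
          \<le> \<eta> * (real (card V))\<^sup>2"
proof -
  interpret op: latin_corner_free V W "G\<inverse>" "\<lambda>x y. s y x"
  proof
    \<comment> \<open>The corner condition of \<open>G\<close> identifies the second coordinates;
      \<open>cancel_right\<close> then identifies the first ones, as the transposed condition
      asks.\<close>
    show "\<And>x y x' y'. (x, y) \<in> G\<inverse> \<Longrightarrow> (x', y') \<in> G\<inverse> \<Longrightarrow> (x, y') \<in> G\<inverse> \<Longrightarrow> s y x = s y' x' \<Longrightarrow> y = y'"
      by (metis SigmaD1 SigmaD2 G_sub cancel_right converse_iff corner_free subsetD)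
  qed (use finite_V finite_W card_W s_in cancel_left cancel_right G_sub in auto)
  have rows: "op.rows w = cols w" for w by (auto simp: op.rows_def cols_def)
  have "{(x, y) \<in> G\<inverse>. real (card (cols (s y x) \<inter> cell \<kappa> (\<kappa> x))) < \<eta> * real (card (cell \<kappa> (\<kappa> x)))}
      = {(x, y) \<in> G. real (card (cols (s x y) \<inter> cell \<kappa> (\<kappa> y))) < \<eta> * real (card (cell \<kappa> (\<kappa> y)))}\<inverse>"
    by auto
  then show ?thesis
    using op.card_thin_rows[OF assms, of \<kappa>] by (simp only: rows card_inverse)
qed

text \<open>A block has at most as many edges as pairs, and there are \<open>k * k\<close>
  blocks.\<close>

lemma card_small_blocks:
  assumes "\<kappa> ` V \<subseteq> {..<k}" "B \<ge> 0"
  shows "real (card {(x, y) \<in> G. real (card (cell \<kappa> (\<kappa> x))) * real (card (cell \<kappa> (\<kappa> y))) < B})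
          \<le> (real k)\<^sup>2 * B"
proof -
  let ?S = "{(x, y) \<in> G. real (card (cell \<kappa> (\<kappa> x))) * real (card (cell \<kappa> (\<kappa> y))) < B}"
  let ?f = "\<lambda>(x, y). (\<kappa> x, \<kappa> y)"
  have fin: "finite ?S" using finite_G by (rule rev_finite_subset) auto
  have im: "?f ` ?S \<subseteq> {..<k} \<times> {..<k}" 
  proof safe
    fix x y assume "(x, y) \<in> G"
    then have "x \<in> V" "y \<in> V" using G_sub by auto
    then show "\<kappa> x < k" "\<kappa> y < k" using assms(1) by auto
  qed
  have "real (card {p\<in>?S. ?f p = t}) \<le> B" for t
  proof (cases "{p\<in>?S. ?f p = t} = {}")
    case True
    then show ?thesis using assms(2) by (simp only: card.empty of_nat_0)
  next
    case False
    then obtain x y where xy: "(x, y) \<in> ?S" "t = (\<kappa> x, \<kappa> y)" by auto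
    have "{p\<in>?S. ?f p = t} \<subseteq> cell \<kappa> (\<kappa> x) \<times> cell \<kappa> (\<kappa> y)"
      using G_sub xy by (auto simp: cell_def)
    then have "card {p\<in>?S. ?f p = t} \<le> card (cell \<kappa> (\<kappa> x) \<times> cell \<kappa> (\<kappa> y))"
      using finite_cell by (intro card_mono) auto
    then have "real (card {p\<in>?S. ?f p = t}) \<le> real (card (cell \<kappa> (\<kappa> x))) * real (card (cell \<kappa> (\<kappa> y)))"
      by (simp add: card_cartesian_product flip: of_nat_mult)
    then show ?thesis using xy by simp
  qed
  then have "(\<Sum>t\<in>{..<k} \<times> {..<k}. real (card {p\<in>?S. ?f p = t})) \<le> (\<Sum>t\<in>{..<k} \<times> {..<k}. B)"
    by (intro sum_mono)
  moreover have "(\<Sum>t\<in>{..<k} \<times> {..<k}. real (card {p\<in>?S. ?f p = t})) = real (card ?S)"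
    using sum.group[OF fin _ im, of "\<lambda>_. 1::real"] by simp
  moreover have "(\<Sum>t\<in>{..<k} \<times> {..<k}. B) = (real k)\<^sup>2 * B"
    by (simp add: card_cartesian_product power2_eq_square)
  ultimately show ?thesis by linarith
qed

section \<open>Decreasing the squared error\<close>

text \<open>Raising a value below \<open>c\<close> costs at most \<open>3 * c^2\<close> per pair and
  saves \<open>2 * c\<close> per edge. With \<open>N = card V\<close>, the saving
  \<open>4 * c^2 * N^2\<close> exceeds the cost by \<open>c^2 * N^2\<close>.\<close>

lemma resid_decrease_raise:
  assumes c: "c > 0"
    and many: "real (card {(x, y) \<in> G. h (\<kappa> x) (\<kappa> y) < c}) \<ge> 2 * c * (real (card V))\<^sup>2"
  shows "resid \<kappa> (\<lambda>a b. if h a b < c then h a b + c else h a b) \<le> resid \<kappa> h - c\<^sup>2 * (real (card V))\<^sup>2"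
proof -
  let ?h = "\<lambda>p. h (\<kappa> (fst p)) (\<kappa> (snd p))"
  let ?E = "{(x, y) \<in> G. h (\<kappa> x) (\<kappa> y) < c}"
  have E: "?E \<subseteq> V \<times> V" using G_sub by auto
  have "resid \<kappa> (\<lambda>a b. if h a b < c then h a b + c else h a b) - resid \<kappa> h
    \<le> (\<Sum>p\<in>V \<times> V. 3 * c\<^sup>2 - 2 * c * of_bool (p \<in> ?E))"
    unfolding resid_def sum_subtractf[symmetric]
  proof (rule sum_mono)
    fix p assume "p \<in> V \<times> V"
    show "(of_bool (p \<in> G) - (if ?h p < c then ?h p + c else ?h p))\<^sup>2 - (of_bool (p \<in> G) - ?h p)\<^sup>2
            \<le> 3 * c\<^sup>2 - 2 * c * of_bool (p \<in> ?E)"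
    proof (cases "?h p < c")
      case True
      have "(of_bool (p \<in> G) - (?h p + c))\<^sup>2 - (of_bool (p \<in> G) - ?h p)\<^sup>2
            = c\<^sup>2 + 2 * (c * ?h p) - 2 * c * of_bool (p \<in> G)"
        by (simp add: power2_eq_square algebra_simps)
      moreover have "c * ?h p \<le> c\<^sup>2"
        using True c by (simp add: power2_eq_square)
      moreover have "of_bool (p \<in> G) = (of_bool (p \<in> ?E) :: real)"
        using True by (auto split: prod.splits)
      ultimately show ?thesis using True by simp
    next
      case False
      then show ?thesis by (auto split: prod.splits)
    qed
  qed
  also have "\<dots> = 3 * c\<^sup>2 * (real (card V))\<^sup>2 - 2 * c * real (card ?E)"
  proof -
    have "(\<Sum>p\<in>V \<times> V. of_bool (p \<in> ?E)) = real (card ?E)"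
      using E finite_V by (simp add: Int_absorb1 sum.If_cases of_bool_def Int_def[symmetric])
    then show ?thesis
      by (simp only: sum_subtractf sum_distrib_left[symmetric])
         (simp add: card_cartesian_product power2_eq_square)
  qed
  also have "\<dots> \<le> 3 * c\<^sup>2 * (real (card V))\<^sup>2 - 2 * c * (2 * c * (real (card V))\<^sup>2)"
    using many c by simp
  also have "\<dots> = - (c\<^sup>2 * (real (card V))\<^sup>2)" by (simp add: power2_eq_square)
  finally show ?thesis by simp
qed


text \<open>The conditions exclude low values of \<open>h\<close>, thin rows, thin columns and small
  blocks. The last one makes \<open>card V\<close>, which bounds the edges of \<open>G\<close> in a
  matching's rectangle, at most \<open>c / 4\<close> times the area of a rectangle filling an
  \<open>\<eta>\<close> share of both sides of the block.\<close>

definition good_edges :: "real \<Rightarrow> real \<Rightarrow> ('v \<Rightarrow> nat) \<Rightarrow> (nat \<Rightarrow> nat \<Rightarrow> real) \<Rightarrow> ('v \<times> 'v) set" where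
  "good_edges c \<eta> \<kappa> h = {(x, y) \<in> G. c \<le> h (\<kappa> x) (\<kappa> y)
      \<and> \<eta> * real (card (cell \<kappa> (\<kappa> x))) \<le> real (card (rows (s x y) \<inter> cell \<kappa> (\<kappa> x)))
      \<and> \<eta> * real (card (cell \<kappa> (\<kappa> y))) \<le> real (card (cols (s x y) \<inter> cell \<kappa> (\<kappa> y)))
      \<and> 4 * real (card V) \<le> c * \<eta>\<^sup>2 * (real (card (cell \<kappa> (\<kappa> x))) * real (card (cell \<kappa> (\<kappa> y))))}"

text \<open>In each block with a good edge one label is chosen. On its rectangle \<open>G\<close>
  has density at most \<open>c / 4\<close> while \<open>h\<close> is at least \<open>c\<close>, so
  the value zero saves at least \<open>c^2 / 2\<close> per pair; the rectangle fills an
  \<open>\<eta>^2\<close> share of the block, and these blocks cover all good edges.\<close>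

lemma resid_decrease_cut:
  assumes c: "c > 0" and \<eta>: "\<eta> > 0" and \<kappa>: "\<kappa> ` V \<subseteq> {..<k}"
  shows "\<exists>\<kappa>' h'. \<kappa>' ` V \<subseteq> {..<k * (2 ^ k * 2 ^ k)}
           \<and> resid \<kappa>' h' \<le> resid \<kappa> h - c\<^sup>2 * \<eta>\<^sup>2 / 2 * real (card (good_edges c \<eta> \<kappa> h))"
proof -
  let ?F = "good_edges c \<eta> \<kappa> h" and ?A = "cell \<kappa>"
  define T where "T = (\<lambda>(x, y). (\<kappa> x, \<kappa> y)) ` ?F"
  have F_G: "?F \<subseteq> G" by (auto simp: good_edges_def)
  have finF: "finite ?F" using F_G finite_G finite_subset by blast
  then have finT: "finite T" by (simp add: T_def)
  have \<kappa>_less: "\<kappa> x < k" if "x \<in> V" for x using \<kappa> that by auto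
  have T_sub: "T \<subseteq> {..<k} \<times> {..<k}"
    using F_G G_sub \<kappa>_less by (fastforce simp: T_def)
  have "\<forall>t\<in>T. \<exists>w. c \<le> h (fst t) (snd t)
      \<and> \<eta> * real (card (?A (fst t))) \<le> real (card (rows w \<inter> ?A (fst t)))
      \<and> \<eta> * real (card (?A (snd t))) \<le> real (card (cols w \<inter> ?A (snd t)))
      \<and> 4 * real (card V) \<le> c * \<eta>\<^sup>2 * (real (card (?A (fst t))) * real (card (?A (snd t))))"
    unfolding T_def good_edges_def by auto
  then obtain w where w: "\<And>t. t \<in> T \<Longrightarrow> c \<le> h (fst t) (snd t)
      \<and> \<eta> * real (card (?A (fst t))) \<le> real (card (rows (w t) \<inter> ?A (fst t)))
      \<and> \<eta> * real (card (?A (snd t))) \<le> real (card (cols (w t) \<inter> ?A (snd t)))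
      \<and> 4 * real (card V) \<le> c * \<eta>\<^sup>2 * (real (card (?A (fst t))) * real (card (?A (snd t))))"
    by metis
  define X where "X t = rows (w t) \<inter> ?A (fst t)" for t
  define Y where "Y t = cols (w t) \<inter> ?A (snd t)" for t
  \<comment> \<open>The refined colour records the old one and membership in each relevant
    \<open>X\<close> and \<open>Y\<close>, hence the factor \<open>2 ^ k * 2 ^ k\<close>.\<close>
  define \<rho> where "\<rho> x = (\<kappa> x, {b\<in>{..<k}. x \<in> X (\<kappa> x, b)}, {a\<in>{..<k}. x \<in> Y (a, \<kappa> x)})" for x
  \<comment> \<open>The refined colours of two points decide whether the pair lies in the rectangle
    cut out of its block.\<close>
  define hh where "hh = (\<lambda>(a, P, Q :: nat set) (b, P' :: nat set, Q').
      if (a, b) \<in> T \<and> b \<in> P \<and> a \<in> Q' then 0 else h a b)"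
  let ?R = "{..<k} \<times> Pow {..<k} \<times> Pow {..<k}"
  have "finite ?R" "card ?R = k * (2 ^ k * 2 ^ k)"
    by (simp_all add: card_cartesian_product card_Pow)
  then obtain f where f: "bij_betw f ?R {..<k * (2 ^ k * 2 ^ k)}"
    using ex_bij_betw_finite_nat[of ?R] by (auto simp: atLeast0LessThan)
  define \<kappa>' where "\<kappa>' x = f (\<rho> x)" for x
  define h' where "h' i j = hh (inv_into ?R f i) (inv_into ?R f j)" for i j
  have \<rho>_in: "\<rho> x \<in> ?R" if "x \<in> V" for x using that \<kappa>_less by (auto simp: \<rho>_def)
  have "\<kappa>' ` V \<subseteq> {..<k * (2 ^ k * 2 ^ k)}"
    using \<rho>_in f by (auto simp: \<kappa>'_def bij_betw_def)
  moreover have "resid \<kappa>' h' \<le> resid \<kappa> h - c\<^sup>2 * \<eta>\<^sup>2 / 2 * real (card ?F)"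
  proof -
    let ?Z = "\<Union>t\<in>T. X t \<times> Y t"
    have val: "h' (\<kappa>' (fst p)) (\<kappa>' (snd p)) = (if p \<in> ?Z then 0 else h (\<kappa> (fst p)) (\<kappa> (snd p)))"
      if pV: "p \<in> V \<times> V" for p
    proof -
      obtain x y where p: "p = (x, y)" "x \<in> V" "y \<in> V" using pV by auto
      have "h' (\<kappa>' x) (\<kappa>' y) = hh (\<rho> x) (\<rho> y)"
        using f \<rho>_in p by (simp add: h'_def \<kappa>'_def bij_betw_def inv_into_f_f)
      also have "\<dots> = (if (\<kappa> x, \<kappa> y) \<in> T \<and> x \<in> X (\<kappa> x, \<kappa> y) \<and> y \<in> Y (\<kappa> x, \<kappa> y) then 0 else h (\<kappa> x) (\<kappa> y))"
        using p \<kappa>_less by (simp add: hh_def \<rho>_def)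
      also have "(\<kappa> x, \<kappa> y) \<in> T \<and> x \<in> X (\<kappa> x, \<kappa> y) \<and> y \<in> Y (\<kappa> x, \<kappa> y) \<longleftrightarrow> p \<in> ?Z"
        by (auto simp: p X_def Y_def cell_def)
      finally show ?thesis by (simp only: p fst_conv snd_conv)
    qed
    \<comment> \<open>\<open>?D p\<close> is the error saved at \<open>p\<close> by the value
      zero.\<close>
    let ?D = "\<lambda>p. (of_bool (p \<in> G) - h (\<kappa> (fst p)) (\<kappa> (snd p)))\<^sup>2 - (of_bool (p \<in> G))\<^sup>2 :: real"
    have Z_sub: "?Z \<subseteq> V \<times> V" by (auto simp: X_def Y_def cell_def)
    have "resid \<kappa> h - resid \<kappa>' h' = (\<Sum>p\<in>V \<times> V. if p \<in> ?Z then ?D p else 0)"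
      unfolding resid_def sum_subtractf[symmetric] by (intro sum.cong refl) (simp only: val, simp)
    also have "\<dots> = sum ?D ?Z"
      using sum.inter_restrict[of "V \<times> V" ?D ?Z] Z_sub finite_V
      by (simp only: Int_absorb1 finite_SigmaI)
    also have "\<dots> = (\<Sum>t\<in>T. sum ?D (X t \<times> Y t))"
    proof (rule sum.UNION_disjoint[OF finT])
      show "\<forall>t\<in>T. finite (X t \<times> Y t)" by (simp add: X_def Y_def finite_cell)
      show "\<forall>t\<in>T. \<forall>u\<in>T. t \<noteq> u \<longrightarrow> X t \<times> Y t \<inter> X u \<times> Y u = {}"
        by (auto simp: X_def Y_def cell_def)
    qed
    finally have diff: "resid \<kappa> h - resid \<kappa>' h' = (\<Sum>t\<in>T. sum ?D (X t \<times> Y t))" .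
    have block: "sum ?D (X t \<times> Y t) \<ge> c\<^sup>2 * \<eta>\<^sup>2 / 2 * real (card (?A (fst t) \<times> ?A (snd t)))"
      if t: "t \<in> T" for t
    proof -
      let ?h = "h (fst t) (snd t)" and ?m = "real (card (X t)) * real (card (Y t))"
      let ?e = "real (card (G \<inter> X t \<times> Y t))"
      have fin: "finite (X t \<times> Y t)" by (simp add: X_def Y_def finite_cell)
      have "card (G \<inter> X t \<times> Y t) \<le> card (G \<inter> rows (w t) \<times> cols (w t))"
        using finite_G by (intro card_mono) (auto simp: X_def Y_def)
      then have "?e \<le> real (card V)" using card_G_rows_cols[of "w t"] by linarith
      moreover have mm: "\<eta>\<^sup>2 * (real (card (?A (fst t))) * real (card (?A (snd t)))) \<le> ?m"
      proof -
        have "(\<eta> * real (card (?A (fst t)))) * (\<eta> * real (card (?A (snd t)))) \<le> ?m"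
          using w[OF t] \<eta> unfolding X_def Y_def by (intro mult_mono) auto
        then show ?thesis by (simp add: power2_eq_square mult_ac)
      qed
      moreover have "4 * real (card V) \<le> c * (\<eta>\<^sup>2 * (real (card (?A (fst t))) * real (card (?A (snd t)))))"
        using w[OF t] by (simp add: mult_ac)
      moreover have "c * (\<eta>\<^sup>2 * (real (card (?A (fst t))) * real (card (?A (snd t))))) \<le> c * ?m"
        using mm c by (intro mult_left_mono) auto
      ultimately have e: "4 * ?e \<le> c * ?m" by linarith
      have hc: "c \<le> ?h" using w[OF t] by simp
      have "sum ?D (X t \<times> Y t) = (\<Sum>p\<in>X t \<times> Y t. ?h\<^sup>2 - 2 * ?h * of_bool (p \<in> G))"
        by (intro sum.cong refl) (auto simp: X_def Y_def cell_def power2_eq_square algebra_simps)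
      also have "\<dots> = ?h\<^sup>2 * ?m - 2 * ?h * ?e"
      proof -
        have "(\<Sum>p\<in>X t \<times> Y t. of_bool (p \<in> G)) = ?e"
          using fin by (simp add: of_bool_def sum.If_cases Int_commute)
        then show ?thesis
          by (simp only: sum_subtractf sum_distrib_left[symmetric]) (simp add: card_cartesian_product)
      qed
      also have "\<dots> \<ge> ?h\<^sup>2 * ?m - ?h * (c * ?m / 2)"
        using mult_left_mono[OF e, of ?h] hc c by simp
      also have "?h\<^sup>2 * ?m - ?h * (c * ?m / 2) = ?h * (?h - c / 2) * ?m"
        by (simp add: power2_eq_square algebra_simps)
      also have "\<dots> \<ge> c * (c / 2) * ?m"
        using hc c by (intro mult_right_mono mult_mono) auto
      also have "c * (c / 2) * ?m \<ge> c * (c / 2) * (\<eta>\<^sup>2 * (real (card (?A (fst t))) * real (card (?A (snd t)))))"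
        using mm c by (intro mult_left_mono) auto
      finally show ?thesis
        by (simp add: card_cartesian_product power2_eq_square mult_ac)
    qed
    have "?F \<subseteq> (\<Union>t\<in>T. ?A (fst t) \<times> ?A (snd t))"
      using F_G G_sub by (force simp: T_def cell_def)
    then have "card ?F \<le> card (\<Union>t\<in>T. ?A (fst t) \<times> ?A (snd t))"
      using finT finite_cell by (intro card_mono) auto
    also have "\<dots> \<le> (\<Sum>t\<in>T. card (?A (fst t) \<times> ?A (snd t)))"
      using finT by (rule card_UN_le)
    finally have "real (card ?F) \<le> (\<Sum>t\<in>T. real (card (?A (fst t) \<times> ?A (snd t))))"
      unfolding of_nat_sum[symmetric] of_nat_le_iff .
    then have "c\<^sup>2 * \<eta>\<^sup>2 / 2 * real (card ?F)
        \<le> c\<^sup>2 * \<eta>\<^sup>2 / 2 * (\<Sum>t\<in>T. real (card (?A (fst t) \<times> ?A (snd t))))"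
      by (intro mult_left_mono) auto
    also have "\<dots> \<le> (\<Sum>t\<in>T. sum ?D (X t \<times> Y t))"
      unfolding sum_distrib_left by (intro sum_mono block)
    finally show ?thesis using diff by linarith
  qed
  ultimately show ?thesis by blast
qed

text \<open>If edges with a low value have density \<open>2 * c\<close>, raising \<open>h\<close>
  suffices. Otherwise, out of \<open>4 * c\<close>, less than \<open>2 * c\<close> is lost to low
  values, at most \<open>c / 4\<close> each to thin rows and thin columns, and at most
  \<open>c / 2\<close> to small blocks by \<open>large\<close>; good edges keep at least
  \<open>c\<close>.\<close>

lemma resid_decrease:
  fixes c :: real
  assumes c: "0 < c" "c \<le> 1" and dense: "real (card G) \<ge> 4 * c * (real (card V))\<^sup>2"
    and large: "real (card V) \<ge> 128 * (real k)\<^sup>2 / c ^ 4"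
    and \<kappa>: "\<kappa> ` V \<subseteq> {..<k}"
  shows "\<exists>\<kappa>' h'. \<kappa>' ` V \<subseteq> {..<k * (2 ^ k * 2 ^ k)}
           \<and> resid \<kappa>' h' \<le> resid \<kappa> h - c ^ 5 / 32 * (real (card V))\<^sup>2"
proof (cases "real (card {(x, y) \<in> G. h (\<kappa> x) (\<kappa> y) < c}) \<ge> 2 * c * (real (card V))\<^sup>2")
  case True
  let ?h = "\<lambda>a b. if h a b < c then h a b + c else h a b"
  have "c ^ 5 \<le> c\<^sup>2" using power_decreasing[of 2 5 c] c by simp
  then have "c ^ 5 / 32 \<le> c\<^sup>2" using zero_le_power2[of c] by linarith
  then have "c ^ 5 / 32 * (real (card V))\<^sup>2 \<le> c\<^sup>2 * (real (card V))\<^sup>2"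
    by (intro mult_right_mono) auto
  moreover have "resid \<kappa> ?h \<le> resid \<kappa> h - c\<^sup>2 * (real (card V))\<^sup>2"
    using resid_decrease_raise[OF c(1) True] .
  \<comment> \<open>The partition is unchanged; the colour bound is weakened to match the other
    case.\<close>
  moreover have "k \<le> k * (2 ^ k * 2 ^ k)" by simp
  then have "\<kappa> ` V \<subseteq> {..<k * (2 ^ k * 2 ^ k)}" using \<kappa> by (meson lessThan_subset_iff order_trans)
  ultimately show ?thesis by (intro exI[of _ \<kappa>] exI[of _ ?h]) auto
next
  case False
  \<comment> \<open>With this value the cut gains \<open>c^2 * \<eta>^2 / 2 * c = c^5 / 32\<close>,
    relative to the square of \<open>card V\<close>.\<close>
  define \<eta> where "\<eta> = c / 4"
  have \<eta>: "\<eta> > 0" using c by (simp add: \<eta>_def)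
  let ?N = "real (card V)"
  let ?E1 = "{(x, y) \<in> G. h (\<kappa> x) (\<kappa> y) < c}"
  let ?E2 = "{(x, y) \<in> G. real (card (rows (s x y) \<inter> cell \<kappa> (\<kappa> x))) < \<eta> * real (card (cell \<kappa> (\<kappa> x)))}"
  let ?E3 = "{(x, y) \<in> G. real (card (cols (s x y) \<inter> cell \<kappa> (\<kappa> y))) < \<eta> * real (card (cell \<kappa> (\<kappa> y)))}"
  let ?B = "4 * ?N / (c * \<eta>\<^sup>2)"
  let ?E4 = "{(x, y) \<in> G. real (card (cell \<kappa> (\<kappa> x))) * real (card (cell \<kappa> (\<kappa> y))) < ?B}"
  let ?F = "good_edges c \<eta> \<kappa> h"
  have B: "u < ?B \<longleftrightarrow> c * \<eta>\<^sup>2 * u < 4 * ?N" for u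
    using c \<eta> by (simp add: pos_less_divide_eq mult_ac)
  have "G \<subseteq> ?E1 \<union> ?E2 \<union> ?E3 \<union> ?E4 \<union> ?F" unfolding B good_edges_def by auto
  then have "card G \<le> card (?E1 \<union> ?E2 \<union> ?E3 \<union> ?E4 \<union> ?F)"
    by (intro card_mono finite_subset[OF _ finite_G]) (auto simp: good_edges_def)
  also have "\<dots> \<le> card ?E1 + card ?E2 + card ?E3 + card ?E4 + card ?F"
    by (intro order_trans[OF card_Un_le] add_mono order_refl)
  finally have "real (card G) \<le> real (card ?E1) + real (card ?E2) + real (card ?E3) + real (card ?E4) + real (card ?F)"
    by linarith
  moreover have "real (card ?E1) \<le> 2 * c * ?N\<^sup>2" using False by linarith
  moreover have "real (card ?E2) \<le> \<eta> * ?N\<^sup>2" "real (card ?E3) \<le> \<eta> * ?N\<^sup>2"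
    using card_thin_rows card_thin_cols \<eta> by simp_all
  moreover have "real (card ?E4) \<le> (real k)\<^sup>2 * ?B"
    using c by (intro card_small_blocks[OF \<kappa>]) simp
  moreover have "(real k)\<^sup>2 * ?B \<le> c / 2 * ?N\<^sup>2"
  proof -
    have "(real k)\<^sup>2 * ?B = c / 2 * (128 * (real k)\<^sup>2 / c ^ 4) * ?N"
      using c by (simp add: \<eta>_def field_simps eval_nat_numeral)
    also have "\<dots> \<le> c / 2 * ?N * ?N"
      using large c by (intro mult_right_mono mult_left_mono) auto
    finally show ?thesis by (simp add: power2_eq_square)
  qed
  ultimately have "real (card ?F) \<ge> c * ?N\<^sup>2"
    using dense by (simp add: \<eta>_def)
  then have "c\<^sup>2 * \<eta>\<^sup>2 / 2 * (c * ?N\<^sup>2) \<le> c\<^sup>2 * \<eta>\<^sup>2 / 2 * real (card ?F)"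
    by (intro mult_left_mono) auto
  moreover have "c\<^sup>2 * \<eta>\<^sup>2 / 2 * (c * ?N\<^sup>2) = c ^ 5 / 32 * ?N\<^sup>2"
    by (simp add: \<eta>_def eval_nat_numeral)
  moreover obtain \<kappa>' h' where "\<kappa>' ` V \<subseteq> {..<k * (2 ^ k * 2 ^ k)}"
    and "resid \<kappa>' h' \<le> resid \<kappa> h - c\<^sup>2 * \<eta>\<^sup>2 / 2 * real (card ?F)"
    using resid_decrease_cut[where h = h, OF c(1) \<eta> \<kappa>] by (elim exE conjE)
  ultimately show ?thesis by (intro exI[of _ \<kappa>'] exI[of _ h'] conjI) (assumption | linarith)+
qed

end

section \<open>Iterating the decrement\<close>

text \<open>Each round applies \<open>resid_decrease\<close> once. The statement is outside the
  locale because \<open>k\<close> and \<open>N\<^sub>0\<close> must serve all \<open>V\<close> and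
  \<open>G\<close> at once.\<close>

lemma resid_iterate:
  fixes c :: real
  assumes "0 < c" "c \<le> 1"
  shows "\<exists>k N\<^sub>0. \<forall>(V :: 'v set) (W :: 'w set) G s. latin_corner_free V W G s \<longrightarrow> N\<^sub>0 \<le> card V
      \<longrightarrow> 4 * c * (real (card V))\<^sup>2 \<le> real (card G)
      \<longrightarrow> (\<exists>\<kappa> h. \<kappa> ` V \<subseteq> {..<k}
            \<and> latin_corner_free.resid V G \<kappa> h \<le> (1 - real j * (c ^ 5 / 32)) * (real (card V))\<^sup>2)"
proof (induction j)
  case 0
  have "\<exists>\<kappa> h. \<kappa> ` V \<subseteq> {..<1}
            \<and> latin_corner_free.resid V G \<kappa> h \<le> (1 - real 0 * (c ^ 5 / 32)) * (real (card V))\<^sup>2"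
    if "latin_corner_free V W G s" for V :: "'v set" and W :: "'w set" and G s
  proof -
    interpret latin_corner_free V W G s by fact
    have "resid (\<lambda>_. 0) (\<lambda>_ _. 0) \<le> (\<Sum>p\<in>V \<times> V. 1)"
      unfolding resid_def by (intro sum_mono) simp
    then have "resid (\<lambda>_. 0) (\<lambda>_ _. 0) \<le> (real (card V))\<^sup>2"
      by (simp add: card_cartesian_product power2_eq_square)
    then show ?thesis by (intro exI[of _ "\<lambda>_. 0"] exI[of _ "\<lambda>_ _. 0"]) auto
  qed
  then show ?case by blast
next
  case (Suc j)
  then obtain k N\<^sub>0 where IH: "\<And>(V :: 'v set) (W :: 'w set) G s. latin_corner_free V W G s \<Longrightarrow> N\<^sub>0 \<le> card V
      \<Longrightarrow> 4 * c * (real (card V))\<^sup>2 \<le> real (card G)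
      \<Longrightarrow> (\<exists>\<kappa> h. \<kappa> ` V \<subseteq> {..<k}
            \<and> latin_corner_free.resid V G \<kappa> h \<le> (1 - real j * (c ^ 5 / 32)) * (real (card V))\<^sup>2)"
    by blast
  \<comment> \<open>The second bound is the hypothesis \<open>large\<close> of
    \<open>resid_decrease\<close> for the current \<open>k\<close>.\<close>
  let ?N1 = "max N\<^sub>0 (nat \<lceil>128 * (real k)\<^sup>2 / c ^ 4\<rceil>)"
  have "\<exists>\<kappa> h. \<kappa> ` V \<subseteq> {..<k * (2 ^ k * 2 ^ k)}
            \<and> latin_corner_free.resid V G \<kappa> h \<le> (1 - real (Suc j) * (c ^ 5 / 32)) * (real (card V))\<^sup>2"
    if l: "latin_corner_free V W G s" and N: "?N1 \<le> card V"
      and dense: "4 * c * (real (card V))\<^sup>2 \<le> real (card G)" for V :: "'v set" and W :: "'w set" and G s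
  proof -
    interpret latin_corner_free V W G s by fact
    obtain \<kappa> h where \<kappa>: "\<kappa> ` V \<subseteq> {..<k}"
      and res: "resid \<kappa> h \<le> (1 - real j * (c ^ 5 / 32)) * (real (card V))\<^sup>2"
      using IH[OF l _ dense] N by auto
    have large: "128 * (real k)\<^sup>2 / c ^ 4 \<le> real (card V)" using N by linarith
    obtain \<kappa>' h' where 1: "\<kappa>' ` V \<subseteq> {..<k * (2 ^ k * 2 ^ k)}"
      and 2: "resid \<kappa>' h' \<le> resid \<kappa> h - c ^ 5 / 32 * (real (card V))\<^sup>2"
      using resid_decrease[where h = h, OF assms dense large \<kappa>] by (elim exE conjE)
    have "resid \<kappa>' h' \<le> (1 - real (Suc j) * (c ^ 5 / 32)) * (real (card V))\<^sup>2"
      using 2 res by (simp add: algebra_simps add_divide_distrib)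
    with 1 show ?thesis by blast
  qed
  then show ?case by blast
qed

text \<open>More than \<open>32 / c^5\<close> decrements would make a sum of squares negative, so a
  large \<open>V\<close> carries no dense \<open>G\<close>.\<close>

theorem latin_corners:
  fixes \<epsilon> :: real
  assumes "\<epsilon> > 0"
  shows "\<exists>N\<^sub>0. \<forall>(V :: 'v set) (W :: 'w set) G s. latin_corner_free V W G s \<longrightarrow> N\<^sub>0 \<le> card V
           \<longrightarrow> real (card G) \<le> \<epsilon> * (real (card V))\<^sup>2"
proof -
  define c where "c = min \<epsilon> 1 / 4"
  have c: "0 < c" "c \<le> 1" "4 * c \<le> \<epsilon>" using assms by (auto simp: c_def)
  obtain j :: nat where j: "1 < real j * (c ^ 5 / 32)"
    using reals_Archimedean3[of "c ^ 5 / 32"] c by (meson divide_pos_pos zero_less_numeral zero_less_power)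
  obtain k N\<^sub>0 where it: "\<And>(V :: 'v set) (W :: 'w set) G s. latin_corner_free V W G s \<Longrightarrow> N\<^sub>0 \<le> card V
      \<Longrightarrow> 4 * c * (real (card V))\<^sup>2 \<le> real (card G)
      \<Longrightarrow> (\<exists>\<kappa> h. \<kappa> ` V \<subseteq> {..<k}
            \<and> latin_corner_free.resid V G \<kappa> h \<le> (1 - real j * (c ^ 5 / 32)) * (real (card V))\<^sup>2)"
    using resid_iterate[OF c(1,2), of j] by blast
  \<comment> \<open>The \<open>1\<close> in \<open>max N\<^sub>0 1\<close> keeps \<open>V\<close>
    nonempty, so that the bound on the error is strictly negative.\<close>
  have "real (card G) \<le> \<epsilon> * (real (card V))\<^sup>2"
    if l: "latin_corner_free V W G s" and N: "max N\<^sub>0 1 \<le> card V" for V :: "'v set" and W :: "'w set" and G s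
  proof (rule ccontr)
    assume neg: "\<not> ?thesis"
    interpret latin_corner_free V W G s by fact
    have "4 * c * (real (card V))\<^sup>2 \<le> \<epsilon> * (real (card V))\<^sup>2"
      using c by (intro mult_right_mono) auto
    then obtain \<kappa> h where res: "resid \<kappa> h \<le> (1 - real j * (c ^ 5 / 32)) * (real (card V))\<^sup>2"
      using it[OF l] N neg by fastforce
    have "resid \<kappa> h \<ge> 0" unfolding resid_def by (intro sum_nonneg) simp
    moreover have "(1 - real j * (c ^ 5 / 32)) * (real (card V))\<^sup>2 < 0"
      using j N by (intro mult_neg_pos) auto
    ultimately show False using res by linarith
  qed
  then show ?thesis by blast
qed

section \<open>Covering codes of lines\<close>

interpretation fv: vector_space "\<lambda>(c :: 'a :: field) (v :: nat \<Rightarrow> 'a). (\<lambda>i. c * v i)"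
  by unfold_locales (auto simp: fun_eq_iff algebra_simps)

lemma fspan_eq_span: "fspan S = fv.span S"
proof -
  have "(\<Sum>u\<in>T. (\<lambda>i. c u * u i)) = (\<lambda>i. \<Sum>u\<in>T. c u * u i)" for T and c :: "(nat \<Rightarrow> 'a) \<Rightarrow> 'a"
    by (induction T rule: infinite_finite_induct) (auto simp: zero_fun_def plus_fun_def)
  then show ?thesis unfolding fspan_def fv.span_explicit by auto
qed

lemma vecs_Suc: "vecs (Suc n) = (\<lambda>(a, v). v(n := a)) ` (UNIV \<times> vecs n)"
proof (intro equalityI subsetI)
  fix v :: "nat \<Rightarrow> 'a" assume "v \<in> vecs (Suc n)"
  then have "v(n := 0) \<in> vecs n" by (auto simp: vecs_def)
  moreover have "v = (\<lambda>(a, v). v(n := a)) (v n, v(n := 0))" by simp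
  ultimately show "v \<in> (\<lambda>(a, v). v(n := a)) ` (UNIV \<times> vecs n)" by blast
qed (auto simp: vecs_def)

lemma finite_card_vecs:
  "finite (vecs n :: (nat \<Rightarrow> 'a::{finite,field}) set) \<and> card (vecs n :: (nat \<Rightarrow> 'a) set) = card (UNIV :: 'a set) ^ n"
proof (induction n)
  case 0
  have "vecs 0 = {\<lambda>_. 0 :: 'a}" by (auto simp: vecs_def)
  then show ?case by simp
next
  case (Suc n)
  have "inj_on (\<lambda>(a, v). v(n := a)) (UNIV \<times> (vecs n :: (nat \<Rightarrow> 'a) set))"
  proof (rule inj_onI, clarify)
    fix a b and u v :: "nat \<Rightarrow> 'a"
    assume u: "u \<in> vecs n" "v \<in> vecs n" and eq: "u(n := a) = v(n := b)"
    have "u i = v i" for i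
      using u fun_cong[OF eq, of i] by (cases "i = n") (auto simp: vecs_def)
    then show "a = b \<and> u = v" using fun_cong[OF eq, of n] by auto
  qed
  then show ?case using Suc by (simp add: vecs_Suc card_image card_cartesian_product)
qed

text \<open>\<open>fdim\<close> is a least size of generating sets, and \<open>B\<close> is one of
  them.\<close>

lemma fdim_span_le: "finite B \<Longrightarrow> fdim (fspan B) \<le> card B"
  unfolding fdim_def by (rule Least_le) (auto simp: fspan_eq_span intro: fv.span_base)

text \<open>The finite space \<open>L\<close> generates itself, so the minimum defining
  \<open>fdim\<close> is attained, here by two vectors.\<close>

lemma grassmannian_2_basis:
  fixes L :: "(nat \<Rightarrow> 'a::{finite,field}) set"
  assumes "L \<in> grassmannian n 2"
  shows "\<exists>u v. u \<in> vecs n \<and> v \<in> vecs n \<and> fspan {u, v} = L"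
proof -
  have L: "L \<subseteq> vecs n" "fspan L = L" "fdim L = 2" using assms by (auto simp: grassmannian_def)
  have "finite L" using L(1) finite_card_vecs finite_subset by blast
  then have "\<exists>B. finite B \<and> B \<subseteq> L \<and> card B = fdim L \<and> fspan B = L"
    using L(2) unfolding fdim_def by (intro LeastI_ex[where P = "\<lambda>d. \<exists>B. finite B \<and> B \<subseteq> L \<and> card B = d \<and> fspan B = L"]) blast
  then obtain B where "B \<subseteq> L" "card B = 2" "fspan B = L" using L(3) by auto
  then show ?thesis using L(1) by (auto simp: card_2_iff)
qed

section \<open>From covering codes to corner-free sets\<close>

text \<open>A nondegenerate corner would put three distinct codewords into a span of three vectors,
  while the code demands dimension 4.\<close>

lemma covering_code_corner_free:
  fixes C :: "(nat \<Rightarrow> 'a::{finite,field}) set set"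
  assumes C: "covering_code n 2 2 3 C"
  shows "\<exists>G. card G = card C \<and> latin_corner_free (vecs n) (vecs n) G (\<lambda>u v :: nat \<Rightarrow> 'a. u + v)"
proof -
  have "\<forall>L\<in>C. \<exists>u v. u \<in> vecs n \<and> v \<in> vecs n \<and> fspan {u, v} = L"
    using C grassmannian_2_basis unfolding covering_code_def by blast
  then obtain f g where fg: "\<And>L. L \<in> C \<Longrightarrow> f L \<in> vecs n \<and> g L \<in> vecs n \<and> fspan {f L, g L} = L"
    by metis
  define G where "G = (\<lambda>L. (f L, g L)) ` C"
  have "inj_on (\<lambda>L. (f L, g L)) C"
    by (rule inj_onI) (metis fg prod.inject)
  then have "card G = card C" by (simp add: G_def card_image)
  moreover have "latin_corner_free (vecs n) (vecs n) G (\<lambda>u v. u + v)"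
  proof
    fix x y x' y' assume G: "(x, y) \<in> G" "(x', y') \<in> G" "(x, y') \<in> G" and sum: "x + y = x' + y'"
    \<comment> \<open>Each pair in \<open>G\<close> is recovered from its span, so distinct pairs
      give distinct codewords.\<close>
    have line: "fspan {a, b} \<in> C \<and> f (fspan {a, b}) = a \<and> g (fspan {a, b}) = b" if ab: "(a, b) \<in> G" for a b
    proof -
      obtain L where "L \<in> C" "a = f L" "b = g L" using ab by (auto simp: G_def)
      then show ?thesis using fg by simp
    qed
    have inC: "fspan {x, y} \<in> C" "fspan {x', y'} \<in> C" "fspan {x, y'} \<in> C"
      using G line by blast+
    have eq: "a = c \<and> b = d" if "(a, b) \<in> G" "(c, d) \<in> G" "fspan {a, b} = fspan {c, d}" for a b c d
      using line[OF that(1)] line[OF that(2)] that(3) by metis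
    show "y = y'"
    proof (rule ccontr)
      assume "y \<noteq> y'"
      moreover from this have "x \<noteq> x'" using sum by auto
      ultimately have three: "card {fspan {x, y}, fspan {x', y'}, fspan {x, y'}} = 3"
        using eq[OF G(1,2)] eq[OF G(1,3)] eq[OF G(2,3)] by (auto simp: card_insert_if)
      have "{fspan {x, y}, fspan {x', y'}, fspan {x, y'}} \<subseteq> C" using inC by simp
      then have "2 + 2 \<le> fdim (fspan (\<Union>{fspan {x, y}, fspan {x', y'}, fspan {x, y'}}))"
        using C[unfolded covering_code_def, THEN conjunct2, rule_format, OF _ three] by blast
      also have "fspan (\<Union>{fspan {x, y}, fspan {x', y'}, fspan {x, y'}}) = fspan {x, y, y'}"
        unfolding fspan_eq_span
      proof (rule fv.span_eq[THEN iffD2], intro conjI)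
        \<comment> \<open>Equal sums place the one remaining vector \<open>x'\<close> in the span of
          the other three.\<close>
        have "x' = x + y - y'" using sum by (simp add: algebra_simps)
        then have "x' \<in> fv.span {x, y, y'}"
          by (auto intro: fv.span_add fv.span_diff fv.span_base)
        then have "{x', y'} \<subseteq> fv.span {x, y, y'}" by (auto intro: fv.span_base)
        then have "fv.span {x', y'} \<subseteq> fv.span {x, y, y'}"
          using fv.span_minimal fv.subspace_span by blast
        moreover have "fv.span {x, y} \<subseteq> fv.span {x, y, y'}" "fv.span {x, y'} \<subseteq> fv.span {x, y, y'}"
          by (auto intro!: fv.span_mono)
        ultimately show "\<Union>{fv.span {x, y}, fv.span {x', y'}, fv.span {x, y'}} \<subseteq> fv.span {x, y, y'}"
          by blast
        have "{x, y, y'} \<subseteq> \<Union>{fv.span {x, y}, fv.span {x', y'}, fv.span {x, y'}}"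
          by (auto intro: fv.span_base)
        then show "{x, y, y'} \<subseteq> fv.span (\<Union>{fv.span {x, y}, fv.span {x', y'}, fv.span {x, y'}})"
          using fv.span_superset by blast
      qed
      also have "fdim (fspan {x, y, y'}) \<le> card {x, y, y'}" by (rule fdim_span_le) simp
      also have "\<dots> \<le> 3" using card_length[of "[x, y, y']"] by simp
      finally show False by simp
    qed
  qed (use finite_card_vecs fg in \<open>auto simp: G_def vecs_def\<close>)
  ultimately show ?thesis by blast
qed

text \<open>Codes consist of subsets of a finite space and the empty code exists, so
  \<open>Max\<close> is taken over a finite nonempty set.\<close>

lemma B_cov_attained:
  "\<exists>C :: (nat \<Rightarrow> 'a::{finite,field}) set set. covering_code n 2 2 3 C \<and> card C = B_cov TYPE('a) n 2 2 3"
proof -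
  let ?S = "{card C | C :: (nat \<Rightarrow> 'a) set set. covering_code n 2 2 3 C}"
  have "?S \<subseteq> card ` Pow (Pow (vecs n :: (nat \<Rightarrow> 'a) set))"
  proof
    fix d assume "d \<in> ?S"
    then obtain C :: "(nat \<Rightarrow> 'a) set set" where C: "covering_code n 2 2 3 C" "d = card C" by blast
    then have "C \<in> Pow (Pow (vecs n))" by (auto simp: covering_code_def grassmannian_def)
    then show "d \<in> card ` Pow (Pow (vecs n :: (nat \<Rightarrow> 'a) set))" using C(2) by simp
  qed
  then have "finite ?S" using finite_card_vecs by (meson finite_Pow_iff finite_imageI finite_subset)
  moreover have "covering_code n 2 2 3 ({} :: (nat \<Rightarrow> 'a) set set)"
    by (auto simp: covering_code_def)
  then have "?S \<noteq> {}" by blast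
  ultimately have "Max ?S \<in> ?S" by (rule Max_in)
  then show ?thesis unfolding B_cov_def by auto
qed

theorem mainTheorem6:
  fixes q :: nat
  assumes "q = card (UNIV :: 'a set)"
  shows "(\<lambda>n. real (B_cov TYPE('a::{finite,field}) n 2 2 3)) \<in> o(\<lambda>n. real q ^ (2 * n))"
proof (rule landau_o.smallI)
  fix \<epsilon> :: real assume "\<epsilon> > 0"
  then obtain N\<^sub>0 where N\<^sub>0: "\<And>(V :: (nat \<Rightarrow> 'a) set) (W :: (nat \<Rightarrow> 'a) set) G s.
      latin_corner_free V W G s \<Longrightarrow> N\<^sub>0 \<le> card V \<Longrightarrow> real (card G) \<le> \<epsilon> * (real (card V))\<^sup>2"
    using latin_corners by meson
  have "2 \<le> q"
    using assms card_mono[of "UNIV :: 'a set" "{0, 1}"] by simp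
  have "norm (real (B_cov TYPE('a) n 2 2 3)) \<le> \<epsilon> * norm (real q ^ (2 * n))" if "n \<ge> N\<^sub>0" for n
  proof -
    obtain C :: "(nat \<Rightarrow> 'a) set set" where C: "covering_code n 2 2 3 C" "card C = B_cov TYPE('a) n 2 2 3"
      using B_cov_attained by blast
    obtain G where G: "card G = card C" "latin_corner_free (vecs n) (vecs n) G (\<lambda>u v :: nat \<Rightarrow> 'a. u + v)"
      using covering_code_corner_free[OF C(1)] by blast
    have card: "card (vecs n :: (nat \<Rightarrow> 'a) set) = q ^ n" using finite_card_vecs assms by blast
    \<comment> \<open>Since \<open>n < q ^ n\<close>, the threshold on the size of the space also
      serves as a threshold on \<open>n\<close>.\<close>
    have "n < 2 ^ n" by (rule less_exp)
    also have "(2 :: nat) ^ n \<le> q ^ n" using \<open>2 \<le> q\<close> by (rule power_mono) simp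
    finally have "N\<^sub>0 \<le> card (vecs n :: (nat \<Rightarrow> 'a) set)" using that card by simp
    then have "real (card G) \<le> \<epsilon> * (real (q ^ n))\<^sup>2" using N\<^sub>0[OF G(2)] card by simp
    then show ?thesis using G(1) C(2) by (simp add: power_mult[symmetric] mult.commute)
  qed
  then show "\<forall>\<^sub>F n in at_top. norm (real (B_cov TYPE('a) n 2 2 3)) \<le> \<epsilon> * norm (real q ^ (2 * n))"
    using eventually_at_top_linorder by blast
qed

end
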